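(* Let $G$ be a connected chordal graph with positive edge lengths and distinct vertices $S,T$. Let $X$ be a set of normal separator paths, and let $G'$ be the graph obtained from $G$ by removing every edge that lies on some path in $X$. Let $r\in X$, let $2\le i<|r|$, and let $u$ be a vertex. If $u$ is strongly $r$-connected to $r_{i-2}$ and there is an edge between $u$ and $r_i$ in $G'$, then $u$, $r_i$ and $r_{i-2}$ lie in a common biconnected component of $G'$.
   Context: A chordal graph is a simple undirected graph in which every cycle with four or more vertices has a chord. Edge lengths are $L(u,v)$; it is assumed that no two different paths between the same ordered pair of vertices have the same length. A path $p=p_0,\dots,p_{|p|-1}$ is a sequence of vertices with consecutive vertices adjacent; $\|p\|$ is the sum of its edge lengths; it is simple if its vertices are distinct; $p_{i,j}$ is the subpath $p_i,\dots,p_j$; $p$ contains $q$ if $q=p_{i,j}$ for some $i\le j$. A path is separating if removing all its edges disconnects $G$. A separator path is a simple separating path not containing any separating path other than itself. A separator path $r$ is traversable if some simple path from $S$ to $T$ contains $r$; useful if $\|r_{i,i+2}\|<L(r_i,r_{i+2})$ for all $0\le i<|r|-2$; normal if it is traversable, useful and has more than two edges. Two vertices $u,v$ are strongly $r$-connected if there is a path between them that shares no edge with $r$ and, except at its endpoints, no vertex with $r$.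
   Formalization: The path making u strongly r-connected to r_{i-2} is required to lie in G'; if it may use edges of G removed with other paths in X, the claim fails (a 7-vertex chordal graph with two normal separator paths is a counterexample). *)

theory Defs
  imports "Graph_Theory.Graph_Theory"
begin

text \<open>
  A finite simple undirected graph is a \<^locale>\<open>pair_graph\<close>: a finite, loop-free symmetric
  digraph whose arcs are pairs of vertices. An undirected edge is the pair of arcs
  \<open>(u, v)\<close>, \<open>(v, u)\<close>. A path in the sense of this theory (consecutive vertices adjacent,
  repetitions allowed) is a \<^const>\<open>vwalk\<close>; a simple path is a \<^const>\<open>vpath\<close>.
\<close>

text \<open>
  The library's \<^const>\<open>pre_digraph.cycle\<close> is a list of arcs, so its length is the number of
  vertices; cycles of length 2 in symmetric digraphs are excluded by the length bound.
\<close>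

definition chordal :: "'a pair_pre_digraph \<Rightarrow> bool" where
  "chordal G \<longleftrightarrow>
     (\<forall>c. pre_digraph.cycle (with_proj G) c \<and> 4 \<le> length c \<longrightarrow>
        (\<exists>(u, v) \<in> parcs G. u \<in> fst ` set c \<and> v \<in> fst ` set c \<and>
           (u, v) \<notin> set c \<and> (v, u) \<notin> set c))"

definition path_edges :: "'a vwalk \<Rightarrow> ('a \<times> 'a) set" where
  "path_edges p = set (vwalk_arcs p) \<union> (set (vwalk_arcs p))\<inverse>"

definition remove_paths :: "'a pair_pre_digraph \<Rightarrow> 'a vwalk set \<Rightarrow> 'a pair_pre_digraph" where
  "remove_paths G X = \<lparr>pverts = pverts G, parcs = parcs G - (\<Union>p\<in>X. path_edges p)\<rparr>"

definition path_length :: "('a \<times> 'a) weight_fun \<Rightarrow> 'a vwalk \<Rightarrow> real" where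
  "path_length L p = sum_list (map L (vwalk_arcs p))"

definition edge_lengths :: "'a pair_pre_digraph \<Rightarrow> ('a \<times> 'a) weight_fun \<Rightarrow> bool" where
  "edge_lengths G L \<longleftrightarrow> (\<forall>(u, v) \<in> parcs G. 0 < L (u, v) \<and> L (u, v) = L (v, u))"

text \<open>
  Only simple paths are compared: if a vertex \<open>a\<close> has two neighbours \<open>b\<close> and \<open>c\<close>, the walks
  \<open>a, b, a, c, a\<close> and \<open>a, c, a, b, a\<close> always have the same length.
\<close>

definition distinct_path_lengths :: "'a pair_pre_digraph \<Rightarrow> ('a \<times> 'a) weight_fun \<Rightarrow> bool" where
  "distinct_path_lengths G L \<longleftrightarrow>
     (\<forall>p q. vpath p (with_proj G) \<and> vpath q (with_proj G) \<and> hd p = hd q \<and> last p = last q \<and>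
        path_length L p = path_length L q \<longrightarrow> p = q)"

definition subpath :: "'a vwalk \<Rightarrow> nat \<Rightarrow> nat \<Rightarrow> 'a vwalk" where
  "subpath p i j = take (Suc j - i) (drop i p)"

definition path_contains :: "'a vwalk \<Rightarrow> 'a vwalk \<Rightarrow> bool" where
  "path_contains p q \<longleftrightarrow> (\<exists>i j. i \<le> j \<and> j < length p \<and> q = subpath p i j)"

definition separating :: "'a pair_pre_digraph \<Rightarrow> 'a vwalk \<Rightarrow> bool" where
  "separating G p \<longleftrightarrow> vwalk p (with_proj G) \<and> \<not> connected (with_proj (remove_paths G {p}))"

definition separator_path :: "'a pair_pre_digraph \<Rightarrow> 'a vwalk \<Rightarrow> bool" where
  "separator_path G r \<longleftrightarrow> vpath r (with_proj G) \<and> separating G r \<and>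
     (\<forall>q. path_contains r q \<and> separating G q \<longrightarrow> q = r)"

definition traversable :: "'a pair_pre_digraph \<Rightarrow> 'a \<Rightarrow> 'a \<Rightarrow> 'a vwalk \<Rightarrow> bool" where
  "traversable G S T r \<longleftrightarrow>
     (\<exists>p. vpath p (with_proj G) \<and> hd p = S \<and> last p = T \<and> path_contains p r)"

text \<open>
  The length of a non-edge is taken to be infinite, so the inequality is required only where
  \<open>r\<^sub>i\<close> and \<open>r\<^sub>i\<^sub>+\<^sub>2\<close> are adjacent. For separator paths in connected chordal graphs they always
  are: the edges of \<open>r\<close> form a cut with connected sides, \<open>r\<^sub>i\<close> and \<open>r\<^sub>i\<^sub>+\<^sub>2\<close> lie on the same side,
  and they are the only neighbours of \<open>r\<^sub>i\<^sub>+\<^sub>1\<close> there, so a shortest path between them within that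
  side would otherwise close a chordless cycle with \<open>r\<^sub>i\<^sub>+\<^sub>1\<close>.
\<close>

definition useful :: "'a pair_pre_digraph \<Rightarrow> ('a \<times> 'a) weight_fun \<Rightarrow> 'a vwalk \<Rightarrow> bool" where
  "useful G L r \<longleftrightarrow>
     (\<forall>i. i + 2 < length r \<and> (r ! i, r ! (i + 2)) \<in> parcs G \<longrightarrow>
        path_length L (subpath r i (i + 2)) < L (r ! i, r ! (i + 2)))"

definition normal_separator_path ::
  "'a pair_pre_digraph \<Rightarrow> ('a \<times> 'a) weight_fun \<Rightarrow> 'a \<Rightarrow> 'a \<Rightarrow> 'a vwalk \<Rightarrow> bool" where
  "normal_separator_path G L S T r \<longleftrightarrow>
     separator_path G r \<and> traversable G S T r \<and> useful G L r \<and> 2 < vwalk_length r"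

text \<open>
  Strong \<open>r\<close>-connectivity of \<open>u\<close> and \<open>v\<close>. The graph \<open>H\<close> carrying the connecting path is a
  parameter, since it may be a proper subgraph of the graph containing \<open>r\<close>.
\<close>

definition strongly_path_connected ::
  "'a pair_pre_digraph \<Rightarrow> 'a vwalk \<Rightarrow> 'a \<Rightarrow> 'a \<Rightarrow> bool" where
  "strongly_path_connected H r u v \<longleftrightarrow>
     (\<exists>p. vwalk p (with_proj H) \<and> hd p = u \<and> last p = v \<and>
        path_edges p \<inter> path_edges r = {} \<and> set p \<inter> set r \<subseteq> {u, v})"

text \<open>
  Biconnected means connected without a cut vertex, so that biconnected components are the blocks
  of a graph; in particular a bridge with its two endpoints is a biconnected component. The side
  condition is needed because \<^const>\<open>connected\<close> excludes the empty graph.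
\<close>

definition biconnected :: "('a, 'b) pre_digraph \<Rightarrow> bool" where
  "biconnected H \<longleftrightarrow> connected H \<and>
     (\<forall>v \<in> verts H. verts H \<noteq> {v} \<longrightarrow> connected (pre_digraph.del_vert H v))"

definition biconnected_component ::
  "('a, 'b) pre_digraph \<Rightarrow> ('a, 'b) pre_digraph \<Rightarrow> bool" where
  "biconnected_component G H \<longleftrightarrow> pre_digraph.max_subgraph G biconnected H"

end

theory Submission
  imports Defs
begin

text \<open>
  The vertices \<open>r\<^sub>i\<^sub>-\<^sub>2\<close> and \<open>r\<^sub>i\<close> are adjacent in \<open>G\<close>, because consecutive edges of a separator path in a
  chordal graph span a triangle. The edge between them survives in \<open>G'\<close>: if it lay on some
  \<open>x \<in> X\<close>, its ends would be disconnected in \<open>G - x\<close>, since every edge of a separator path crosses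
  the cut, but the path from \<open>r\<^sub>i\<^sub>-\<^sub>2\<close> to \<open>u\<close> together with the edge from \<open>u\<close> to \<open>r\<^sub>i\<close> joins them in \<open>G'\<close>.
  So this path closes to a cycle of \<open>G'\<close> through the three vertices.
\<close>

section \<open>Walks as vertex lists: arcs, edges and reachability\<close>

lemma set_vwalk_arcs_conv_nth:
  "set (vwalk_arcs p) = {(p ! k, p ! Suc k) | k. Suc k < length p}"
proof (induction p rule: vwalk_arcs.induct)
  case (3 x y xs)
  have "{((x # y # xs) ! k, (x # y # xs) ! Suc k) | k. Suc k < length (x # y # xs)}
      = insert (x, y) {((y # xs) ! k, (y # xs) ! Suc k) | k. Suc k < length (y # xs)}"
    (is "?A = ?B")
  proof
    show "?A \<subseteq> ?B"
    proof
      fix e assume "e \<in> ?A"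
      then obtain k where "e = ((x # y # xs) ! k, (x # y # xs) ! Suc k)"
        "Suc k < length (x # y # xs)" by blast
      then show "e \<in> ?B" by (cases k) auto
    qed
  next
    show "?B \<subseteq> ?A"
    proof
      fix e assume "e \<in> ?B"
      then consider "e = (x, y)"
        | k where "e = ((y # xs) ! k, (y # xs) ! Suc k)" "Suc k < length (y # xs)" by blast
      then show "e \<in> ?A"
      proof cases
        case 1
        then show ?thesis by (auto intro!: exI[of _ 0])
      next
        case 2
        then show ?thesis by (auto intro!: exI[of _ "Suc k"])
      qed
    qed
  qed
  with 3 show ?case by simp
qed auto

lemma path_edges_conv_nth:
  "path_edges p =
    {(p ! k, p ! Suc k) | k. Suc k < length p} \<union> {(p ! Suc k, p ! k) | k. Suc k < length p}"
  unfolding path_edges_def set_vwalk_arcs_conv_nth by blast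

lemma sym_path_edges: "sym (path_edges p)"
  unfolding path_edges_def by (auto intro: symI)

lemma sym_diff_path_edges: "sym E \<Longrightarrow> sym (E - (\<Union>p\<in>X. path_edges p))"
  by (rule symI) (auto dest: symD[OF sym_path_edges] symD)

lemma successively_iff_vwalk_arcs:
  "successively (\<lambda>x y. (x, y) \<in> E) p \<longleftrightarrow> set (vwalk_arcs p) \<subseteq> E"
  by (induction p rule: vwalk_arcs.induct) auto

lemma map_fst_vwalk_arcs: "map fst (vwalk_arcs p) = butlast p"
  by (induction p rule: vwalk_arcs.induct) auto

lemma pawalk_verts_vwalk_arcs: "p \<noteq> [] \<Longrightarrow> pawalk_verts (hd p) (vwalk_arcs p) = p"
  by (induction p rule: vwalk_arcs.induct) auto

lemma pcas_vwalk_arcs: "p \<noteq> [] \<Longrightarrow> pcas (hd p) (vwalk_arcs p) (last p)"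
  by (induction p rule: vwalk_arcs.induct) auto

lemma rtrancl_imp_successively:
  assumes "(a, b) \<in> E\<^sup>*"
  shows "\<exists>p. p \<noteq> [] \<and> hd p = a \<and> last p = b \<and> successively (\<lambda>x y. (x, y) \<in> E) p"
  using assms
proof (induction rule: rtrancl_induct)
  case base
  show ?case by (rule exI[of _ "[a]"]) simp
next
  case (step y z)
  then obtain p where p: "p \<noteq> []" "hd p = a" "last p = y" "successively (\<lambda>x y. (x, y) \<in> E) p"
    by blast
  with step(2) show ?case
    by (intro exI[of _ "p @ [z]"]) (auto simp: successively_append_iff)
qed

text \<open>Confining the relation to the vertices of \<open>p\<close> yields reachability inside an
  induced subgraph, the form needed in \<open>connected_walk\<close>.\<close>

lemma successively_imp_rtrancl:
  assumes "successively (\<lambda>x y. (x, y) \<in> E) p" "x \<in> set p"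
  shows "(hd p, x) \<in> (E \<inter> set p \<times> set p)\<^sup>*"
proof -
  obtain p1 p2 where p: "p = p1 @ x # p2" using assms(2) by (meson split_list)
  have "(hd (q @ [y]), y) \<in> (E \<inter> set (q @ [y]) \<times> set (q @ [y]))\<^sup>*"
    if "successively (\<lambda>x y. (x, y) \<in> E) (q @ [y])" for q y
    using that
  proof (induction q arbitrary: y rule: rev_induct)
    case (snoc z q)
    let ?S = "\<lambda>l. E \<inter> set l \<times> set l"
    have "successively (\<lambda>x y. (x, y) \<in> E) (q @ [z])" "(z, y) \<in> E"
      using snoc.prems by (auto simp: successively_append_iff)
    with snoc.IH have "(hd (q @ [z]), z) \<in> (?S (q @ [z]))\<^sup>*" by blast
    moreover have "?S (q @ [z]) \<subseteq> ?S ((q @ [z]) @ [y])" by auto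
    ultimately have "(hd (q @ [z]), z) \<in> (?S ((q @ [z]) @ [y]))\<^sup>*"
      using rtrancl_mono by blast
    moreover have "(z, y) \<in> ?S ((q @ [z]) @ [y])" using \<open>(z, y) \<in> E\<close> by auto
    ultimately have "(hd (q @ [z]), y) \<in> (?S ((q @ [z]) @ [y]))\<^sup>*"
      by (rule rtrancl.rtrancl_into_rtrancl)
    moreover have "hd ((q @ [z]) @ [y]) = hd (q @ [z])" by (simp add: hd_append)
    ultimately show ?case by (simp only:)
  qed simp
  moreover have "successively (\<lambda>x y. (x, y) \<in> E) (p1 @ [x])"
    using assms(1) p by (auto simp: successively_append_iff)
  ultimately have "(hd (p1 @ [x]), x) \<in> (E \<inter> set (p1 @ [x]) \<times> set (p1 @ [x]))\<^sup>*" by blast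
  moreover have "E \<inter> set (p1 @ [x]) \<times> set (p1 @ [x]) \<subseteq> E \<inter> set p \<times> set p" using p by auto
  moreover have "hd (p1 @ [x]) = hd p" using p by (simp add: hd_append)
  ultimately show ?thesis
    using rtrancl_mono[of "E \<inter> set (p1 @ [x]) \<times> set (p1 @ [x])" "E \<inter> set p \<times> set p"]
    by (simp only: subset_iff)
qed

text \<open>The ends of a chord may occur on a walk in either order; splitting at both prepares
  shortcuts between them.\<close>

lemma in_set_conv_ordered_decomp:
  assumes "x \<in> set p" "y \<in> set p" "x \<noteq> y"
  shows "\<exists>p1 p2 p3. p = p1 @ x # p2 @ y # p3 \<or> p = p1 @ y # p2 @ x # p3"
proof -
  obtain p1 p2 where p: "p = p1 @ x # p2" using assms(1) by (meson split_list)
  with assms consider "y \<in> set p1" | "y \<in> set p2" by auto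
  then show ?thesis
  proof cases
    case 1
    then obtain a b where "p1 = a @ y # b" by (meson split_list)
    with p show ?thesis by auto
  next
    case 2
    then obtain a b where "p2 = a @ y # b" by (meson split_list)
    with p show ?thesis by auto
  qed
qed

section \<open>Connectivity of symmetric digraphs\<close>

lemma connected_with_proj_iff:
  assumes "pair_wf_digraph H" "sym (parcs H)"
  shows "connected (with_proj H) \<longleftrightarrow>
    pverts H \<noteq> {} \<and> (\<forall>u \<in> pverts H. \<forall>v \<in> pverts H. (u, v) \<in> (parcs H)\<^sup>*)"
proof -
  interpret pair_wf_digraph H by fact
  have sy: "(parcs H)\<^sup>s = parcs H"
    using assms(2) by (auto simp: symcl_def sym_def)
  \<comment> \<open>The two closures differ only in reflexive pairs outside the vertex set, since
    arcs end at vertices.\<close>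
  have "(u, v) \<in> rtrancl_on (pverts H) (parcs H) \<longleftrightarrow> (u, v) \<in> (parcs H)\<^sup>*"
    if "u \<in> pverts H" for u v
  proof
    assume "(u, v) \<in> rtrancl_on (pverts H) (parcs H)"
    then show "(u, v) \<in> (parcs H)\<^sup>*"
      by (induction rule: rtrancl_on.induct) auto
  next
    assume "(u, v) \<in> (parcs H)\<^sup>*"
    then show "(u, v) \<in> rtrancl_on (pverts H) (parcs H)"
    proof (induction rule: rtrancl_induct)
      case base
      then show ?case using that by simp
    next
      case (step y z)
      then show ?case
        by (meson in_arcsD2 rtrancl_on_into_rtrancl_on)
    qed
  qed
  then show ?thesis
    unfolding connected_conv by (simp add: sy)
qed

lemma (in pair_graph) sym_parcs: "sym (parcs G)"
  using arcs_symmetric by (auto intro: symI)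

lemma (in pair_graph) connected_remove_paths_iff:
  "connected (with_proj (remove_paths G X)) \<longleftrightarrow>
    pverts G \<noteq> {} \<and>
    (\<forall>u \<in> pverts G. \<forall>v \<in> pverts G. (u, v) \<in> (parcs G - (\<Union>p\<in>X. path_edges p))\<^sup>*)"
proof -
  have "pair_wf_digraph (remove_paths G X)"
    by unfold_locales (auto simp: remove_paths_def dest: wellformed')
  moreover have "sym (parcs (remove_paths G X))"
    by (simp add: remove_paths_def sym_diff_path_edges sym_parcs)
  ultimately show ?thesis
    using connected_with_proj_iff[of "remove_paths G X"] by (simp add: remove_paths_def)
qed

section \<open>Cuts in chordal graphs\<close>

text \<open>
  In a chordal graph it suffices to look at triangles: a shortest path in
  \<open>G - F\<close> joining the ends of an edge of \<open>F\<close> has no chord, since a chord in \<open>F\<close> and a chord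
  outside \<open>F\<close> both lead to a shorter such path.
\<close>

lemma (in pair_graph) chordal_disconnectedI:
  assumes chordal: "chordal G" and F: "F \<subseteq> parcs G" "sym F"
    and triangle: "\<And>a b c. (a, b) \<in> F \<Longrightarrow> (b, c) \<in> parcs G - F \<Longrightarrow> (c, a) \<notin> parcs G - F"
    and ab: "(a, b) \<in> F"
  shows "(a, b) \<notin> (parcs G - F)\<^sup>*"
proof
  let ?E = "parcs G - F"
  \<comment> \<open>The closing edge may be any edge of \<open>F\<close>, not just the given one: a
    chord in \<open>F\<close> yields a shorter walk with different ends.\<close>
  define Q where "Q p \<longleftrightarrow> p \<noteq> [] \<and> successively (\<lambda>x y. (x, y) \<in> ?E) p \<and> (last p, hd p) \<in> F" for p
  assume "(a, b) \<in> ?E\<^sup>*"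
  then obtain p0 where "p0 \<noteq> []" "hd p0 = a" "last p0 = b"
    "successively (\<lambda>x y. (x, y) \<in> ?E) p0"
    using rtrancl_imp_successively by metis
  moreover have "(b, a) \<in> F" using ab F by (auto dest: symD)
  ultimately have "Q p0" by (simp add: Q_def)
  then obtain p where p: "Q p" and min: "\<And>q. Q q \<Longrightarrow> length p \<le> length q"
    using ex_has_least_nat[of Q p0 length] by blast
  \<comment> \<open>A chord in \<open>F\<close> closes the segment from \<open>x\<close> to
    \<open>y\<close>, which is shorter because \<open>p1\<close> or \<open>p3\<close> is nonempty. A
    chord outside \<open>F\<close> replaces the nonempty \<open>p2\<close>.\<close>
  have no_chord: False
    if "p = p1 @ x # p2 @ y # p3" "(x, y) \<in> parcs G" "p2 \<noteq> []" "p1 \<noteq> [] \<or> p3 \<noteq> []"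
    for p1 x p2 y p3
  proof (cases "(x, y) \<in> F")
    case True
    then have "(y, x) \<in> F" using F by (auto dest: symD)
    then have "Q (x # p2 @ [y])"
      using p that(1,3) by (auto simp: Q_def successively_append_iff successively_Cons)
    from min[OF this] that show False by auto
  next
    case False
    then have "Q (p1 @ x # y # p3)"
      using p that(1,2)
      by (auto simp: Q_def successively_append_iff successively_Cons hd_append split: if_splits)
    from min[OF this] that show False by auto
  qed
  have dist: "distinct p"
  proof (rule ccontr)
    assume "\<not> distinct p"
    then obtain p1 x p2 p3 where p_eq: "p = p1 @ [x] @ p2 @ [x] @ p3"
      using not_distinct_decomp by blast
    then have "Q (p1 @ x # p3)"
      using p by (auto simp: Q_def successively_append_iff successively_Cons hd_append split: if_splits)
    from min[OF this] p_eq show False by auto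
  qed
  have closing: "(last p, hd p) \<in> F" and ne: "p \<noteq> []" using p by (auto simp: Q_def)
  \<comment> \<open>One vertex would give a loop, two an edge both in \<open>F\<close> and outside
    it, three a triangle excluded by hypothesis.\<close>
  have "4 \<le> length p"
  proof (rule ccontr)
    assume "\<not> 4 \<le> length p"
    with ne consider x where "p = [x]" | x y where "p = [x, y]" | x y z where "p = [x, y, z]"
      by (cases p rule: list.exhaust; cases "tl p"; cases "tl (tl p)"; cases "tl (tl (tl p))") auto
    then show False
    proof cases
      case 1
      with closing F show False by (auto dest: no_loops')
    next
      case 2
      with p F show False by (auto simp: Q_def dest: symD)
    next
      case 3
      then have "(z, x) \<in> F" "(x, y) \<in> ?E" "(y, z) \<in> ?E" using p by (auto simp: Q_def)
      with triangle show False by blast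
    qed
  qed
  define c where "c = vwalk_arcs (p @ [hd p])"
  have c: "c = vwalk_arcs p @ [(last p, hd p)]"
    using ne by (simp add: c_def vwalk_arcs_append)
  have c_arcs: "set c \<subseteq> parcs G"
    using p F unfolding c Q_def successively_iff_vwalk_arcs by auto
  have c_verts: "fst ` set c = set p"
  proof -
    have "fst ` set c = set (map fst c)" by simp
    also have "\<dots> = set p" unfolding c_def map_fst_vwalk_arcs by simp
    finally show ?thesis .
  qed
  have "pcas (hd p) c (hd p)"
    using pcas_vwalk_arcs[of "p @ [hd p]"] ne by (simp add: c_def)
  moreover have "pawalk_verts (hd p) c = p @ [hd p]"
    using pawalk_verts_vwalk_arcs[of "p @ [hd p]"] ne by (simp add: c_def)
  moreover have "hd p \<in> pverts G" using closing F wellformed' by blast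
  moreover have "distinct (tl (p @ [hd p]))" using dist ne by (cases p) auto
  ultimately have "cycle c"
    using c_arcs c unfolding cycle_def awalk_def by (auto intro!: exI[of _ "hd p"])
  moreover have "4 \<le> length c"
    using \<open>4 \<le> length p\<close> unfolding c vwalk_length_simp[unfolded vwalk_length_def] length_append
    by simp
  ultimately obtain x y where xy: "(x, y) \<in> parcs G" "x \<in> set p" "y \<in> set p"
    "(x, y) \<notin> set c" "(y, x) \<notin> set c"
    using chordal c_verts unfolding chordal_def by fastforce
  \<comment> \<open>If \<open>p2\<close> were empty, the chord would be an arc of \<open>c\<close>;
    if \<open>p1\<close> and \<open>p3\<close> were, it would be the closing arc reversed.\<close>
  have chord: False if "p = p1 @ x # p2 @ y # p3" "(x, y) \<in> parcs G"
      "(x, y) \<notin> set c" "(y, x) \<notin> set c" for p1 p2 p3 x y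
  proof (rule no_chord[OF that(1,2)])
    show "p2 \<noteq> []"
    proof
      assume "p2 = []"
      then have "(x, y) \<in> set (vwalk_arcs p)"
        using that(1) by (cases "p1 = []") (auto simp: vwalk_arcs_append)
      with that(3) c show False by simp
    qed
    show "p1 \<noteq> [] \<or> p3 \<noteq> []" using that(1,4) c by auto
  qed
  have "x \<noteq> y" using xy(1) no_loops' by blast
  with in_set_conv_ordered_decomp[OF xy(2,3)] chord xy arcs_symmetric show False by meson
qed

section \<open>Edges and triangles of separator paths\<close>

lemma sym_rtranclD: "sym E \<Longrightarrow> (a, b) \<in> E\<^sup>* \<Longrightarrow> (b, a) \<in> E\<^sup>*"
  by (rule symD[OF sym_rtrancl])

text \<open>
  The first edge of \<open>x\<close> crosses the cut because \<open>tl x\<close> is not separating, and crossing propagates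
  along triangles \<open>x\<^sub>k x\<^sub>k\<^sub>+\<^sub>1 x\<^sub>k\<^sub>+\<^sub>2\<close>. If \<open>j\<close> were the first index without such a triangle, no triangle
  would contain exactly one of the first \<open>j + 1\<close> edges, so these would already form a separating
  path.
\<close>

lemma (in pair_graph) separator_path_structure:
  assumes conn: "connected (with_proj G)" and chordal: "chordal G"
    and sep: "separator_path G x"
  shows separator_path_crossing:
      "Suc j < length x \<Longrightarrow> (x ! j, x ! Suc j) \<notin> (parcs G - path_edges x)\<^sup>*" (is "_ \<Longrightarrow> ?cross j")
    and separator_path_triangle:
      "j + 2 < length x \<Longrightarrow> (x ! j, x ! (j + 2)) \<in> parcs G" (is "_ \<Longrightarrow> ?tri j")
proof -
  let ?E = "parcs G - path_edges x"
  have walk: "vwalk x (with_proj G)" and dist: "distinct x" and "separating G x"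
    and minimal: "\<And>q. path_contains x q \<Longrightarrow> separating G q \<Longrightarrow> q = x"
    using sep by (auto simp: separator_path_def vpath_def)
  have ne: "x \<noteq> []" and verts: "set x \<subseteq> pverts G" and arcs: "set (vwalk_arcs x) \<subseteq> parcs G"
    using walk by (auto simp: vwalk_def)
  have edge: "(x ! k, x ! Suc k) \<in> parcs G" if "Suc k < length x" for k
    using that arcs unfolding set_vwalk_arcs_conv_nth by blast
  have symE: "sym ?E"
    using sym_diff_path_edges[OF sym_parcs, of "{x}"] by simp
  have verts_ne: "pverts G \<noteq> {}" using ne verts by (cases x) auto
  have all_conn: "(u, v) \<in> (parcs G)\<^sup>*" if "u \<in> pverts G" "v \<in> pverts G" for u v
    using conn that connected_with_proj_iff[OF pair_wf_digraph sym_parcs] by blast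
  have "\<exists>u \<in> pverts G. \<exists>v \<in> pverts G. (u, v) \<notin> ?E\<^sup>*"
    using \<open>separating G x\<close> verts_ne unfolding separating_def connected_remove_paths_iff by auto
  then obtain s t where st: "s \<in> pverts G" "t \<in> pverts G" "(s, t) \<notin> ?E\<^sup>*" by blast
  have chord_not_path: "(x ! k, x ! (k + 2)) \<notin> path_edges x" if "k + 2 < length x" for k
    using that dist by (auto simp: path_edges_conv_nth nth_eq_iff_index_eq)
  \<comment> \<open>A path with a single vertex has no edges, so removing it would leave
    \<open>G\<close> connected.\<close>
  obtain a y xs where x_eq: "x = a # y # xs"
  proof (cases x rule: vwalk_arcs.cases)
    case (2 z)
    then have "?E = parcs G" by (simp add: path_edges_def)
    with st all_conn show ?thesis by simp
  qed (use ne that in auto)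
  have cross0: "?cross 0"
  proof
    assume reach: "(x ! 0, x ! Suc 0) \<in> ?E\<^sup>*"
    have "tl x = subpath x 1 (length x - 1)" by (simp add: subpath_def x_eq)
    then have "path_contains x (tl x)"
      unfolding path_contains_def x_eq by (intro exI[of _ 1] exI[of _ "length x - 1"]) (simp add: x_eq)
    moreover have "tl x \<noteq> x" by (simp add: x_eq)
    ultimately have "\<not> separating G (tl x)" using minimal by blast
    moreover have "vwalk (tl x) (with_proj G)" using walk by (simp add: x_eq vwalk_def)
    ultimately have "(s, t) \<in> (parcs G - path_edges (tl x))\<^sup>*"
      using st unfolding separating_def connected_remove_paths_iff by auto
    \<comment> \<open>Compared with \<open>x\<close>, the path \<open>tl x\<close> spares only the
      first edge, whose ends are connected in \<open>?E\<close> by \<open>reach\<close>.\<close>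
    moreover have "parcs G - path_edges (tl x) \<subseteq> ?E\<^sup>*"
    proof -
      have "path_edges x = path_edges (tl x) \<union> {(a, y), (y, a)}"
        by (auto simp: path_edges_def x_eq)
      moreover have "(a, y) \<in> ?E\<^sup>*" "(y, a) \<in> ?E\<^sup>*"
        using reach sym_rtranclD[OF symE] by (auto simp: x_eq)
      ultimately show ?thesis by auto
    qed
    ultimately have "(s, t) \<in> ?E\<^sup>*" using rtrancl_subset_rtrancl by blast
    with st show False by blast
  qed
  \<comment> \<open>The third side of the triangle is not on \<open>x\<close>, so a connection
    between the ends of edge \<open>k + 1\<close> would also connect those of edge
    \<open>k\<close>.\<close>
  have cross_step: "?cross (Suc k)" if "k + 2 < length x" "?cross k" "?tri k" for k
  proof
    assume "(x ! Suc k, x ! Suc (Suc k)) \<in> ?E\<^sup>*"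
    then have "(x ! Suc (Suc k), x ! Suc k) \<in> ?E\<^sup>*" by (rule sym_rtranclD[OF symE])
    moreover have "(x ! k, x ! Suc (Suc k)) \<in> ?E"
      using that chord_not_path[of k] by simp
    ultimately have "(x ! k, x ! Suc k) \<in> ?E\<^sup>*" by (meson converse_rtrancl_into_rtrancl)
    with that show False by blast
  qed
  have cross_upto: "?cross k" if "Suc k < length x" "\<forall>i<k. ?tri i" for k
    using that
  proof (induction k)
    case 0
    then show ?case using cross0 by simp
  next
    case (Suc k)
    then show ?case using cross_step[of k] by simp
  qed
  have tri: "?tri k" if "k + 2 < length x" for k
    using that
  proof (induction k rule: less_induct)
    case (less j)
    show ?case
    proof (rule ccontr)
      assume no_tri: "\<not> ?tri j"
      \<comment> \<open>The first \<open>j + 2\<close> vertices carry exactly the edges with indices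
        \<open>0\<close> to \<open>j\<close>.\<close>
      define F where "F = path_edges (take (j + 2) x)"
      have F_eq: "F = {(x ! k, x ! Suc k) | k. k \<le> j} \<union> {(x ! Suc k, x ! k) | k. k \<le> j}"
        unfolding F_def path_edges_conv_nth
        by (rule arg_cong2[of _ _ _ _ "(\<union>)"]; rule Collect_cong, rule ex_cong1)
          (use less.prems in auto)
      have symF: "sym (parcs G - F)"
        using sym_diff_path_edges[OF sym_parcs, of "{take (j + 2) x}"] by (simp add: F_def)
      have crossing: "?cross k" if "k \<le> j" for k
        using that less by (intro cross_upto) auto
      have no_third: False
        if k: "k \<le> j" and c: "(x ! k, c) \<in> parcs G - F" "(x ! Suc k, c) \<in> parcs G - F" for k c
      proof -
        have *: "(c, x ! k) \<in> parcs G - F" "(c, x ! Suc k) \<in> parcs G - F"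
          by (rule symD[OF symF c(1)], rule symD[OF symF c(2)])
        \<comment> \<open>Otherwise the detour through \<open>c\<close> would connect the ends of a
          crossing edge.\<close>
        have "(x ! k, c) \<in> path_edges x \<or> (x ! Suc k, c) \<in> path_edges x"
        proof (rule ccontr)
          assume "\<not> ?thesis"
          then have "(x ! k, c) \<in> ?E" "(x ! Suc k, c) \<in> ?E" using c by auto
          then have "(x ! k, x ! Suc k) \<in> ?E\<^sup>*"
            by (meson symE symD converse_rtrancl_into_rtrancl r_into_rtrancl)
          with crossing k show False by blast
        qed
        then obtain z m where z: "z = k \<or> z = Suc k" and m: "Suc m < length x"
          and "x ! z = x ! m \<and> c = x ! Suc m \<or> x ! z = x ! Suc m \<and> c = x ! m"
          unfolding path_edges_conv_nth by blast
        then have zm: "z = m \<and> c = x ! Suc m \<or> z = Suc m \<and> c = x ! m"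
          using dist k less.prems by (auto simp: nth_eq_iff_index_eq)
        have "(x ! z, c) \<notin> F" using z c by auto
        then have "\<not> m \<le> j" using zm unfolding F_eq by blast
        \<comment> \<open>The edge of \<open>x\<close> at index \<open>m > j\<close> meets an edge
          of index at most \<open>j\<close>, so it must be the very next one. Then \<open>c\<close>
          is \<open>x ! (j + 2)\<close>, and the side from \<open>x ! j\<close> to \<open>c\<close>
          is the arc denied by \<open>no_tri\<close>.\<close>
        then have "k = j" "z = Suc k" "m = Suc k" "c = x ! Suc m" using zm z k by auto
        then have "k = j" "c = x ! (j + 2)" by simp_all
        with c no_tri show False by simp
      qed
      have "(x ! 0, x ! 1) \<notin> (parcs G - F)\<^sup>*"
      proof (rule chordal_disconnectedI[OF chordal])
        show "F \<subseteq> parcs G"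
          using edge arcs_symmetric less.prems unfolding F_eq by auto
        show "sym F" unfolding F_def by (rule sym_path_edges)
        show "(x ! 0, x ! 1) \<in> F" unfolding F_eq by force
        show "(c, a) \<notin> parcs G - F"
          if "(a, b) \<in> F" "(b, c) \<in> parcs G - F" for a b c
        proof
          assume "(c, a) \<in> parcs G - F"
          then have "(a, c) \<in> parcs G - F" by (rule symD[OF symF])
          with that no_third show False unfolding F_eq by blast
        qed
      qed
      moreover have "x ! 0 \<in> pverts G" "x ! 1 \<in> pverts G" using verts by (auto simp: x_eq)
      moreover have "vwalk (take (j + 2) x) (with_proj G)"
        using set_vwalk_arcs_append1[of "take (j + 2) x" "drop (j + 2) x"] ne verts arcs
        by (auto simp: vwalk_def dest: in_set_takeD)
      ultimately have "separating G (take (j + 2) x)"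
        unfolding separating_def connected_remove_paths_iff F_def[symmetric]
        by (auto simp: F_def)
      moreover have "path_contains x (take (j + 2) x)"
        unfolding path_contains_def subpath_def
        using less.prems by (intro exI[of _ 0] exI[of _ "Suc j"]) simp
      \<comment> \<open>This is absurd because \<open>j + 2 < length x\<close> makes the prefix
        proper.\<close>
      ultimately have "take (j + 2) x = x" using minimal by blast
      then have "length (take (j + 2) x) = length x" by simp
      with less.prems show False by simp
    qed
  qed
  show "?cross j" if "Suc j < length x" using that cross_upto tri by simp
  show "?tri j" if "j + 2 < length x" using that by (rule tri)
qed

lemma (in pair_graph) separator_path_edge_disconnected:
  assumes "connected (with_proj G)" "chordal G" "separator_path G x" "(a, b) \<in> path_edges x"
  shows "(a, b) \<notin> (parcs G - path_edges x)\<^sup>*"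
proof -
  have "sym (parcs G - path_edges x)"
    using sym_diff_path_edges[OF sym_parcs, of "{x}"] by simp
  moreover obtain k where "Suc k < length x"
    "(a, b) = (x ! k, x ! Suc k) \<or> (b, a) = (x ! k, x ! Suc k)"
    using assms(4) by (auto simp: path_edges_conv_nth)
  ultimately show ?thesis
    using separator_path_crossing[OF assms(1-3)] sym_rtranclD by (metis prod.inject)
qed

section \<open>Biconnected subgraphs and their maximal extensions\<close>

lemma connected_walk:
  assumes "p \<noteq> []" "successively (\<lambda>x y. (x, y) \<in> E) p" "sym E"
  shows "connected (with_proj \<lparr>pverts = set p, parcs = E \<inter> set p \<times> set p\<rparr>)"
    (is "connected (with_proj ?H)")
proof -
  have "pair_wf_digraph ?H" by unfold_locales auto
  moreover have sy: "sym (parcs ?H)" using assms(3) by (auto simp: sym_def)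
  moreover have "(u, v) \<in> (parcs ?H)\<^sup>*" if "u \<in> set p" "v \<in> set p" for u v
    using successively_imp_rtrancl[OF assms(2)] sym_rtranclD[OF sy] that
    by simp (meson rtrancl_trans)
  ultimately show ?thesis using connected_with_proj_iff[of ?H] assms(1) by simp
qed

lemma biconnected_cycle:
  assumes "c \<noteq> []" "distinct c" "successively (\<lambda>x y. (x, y) \<in> E) c" "(last c, hd c) \<in> E"
    and "sym E"
  shows "biconnected (with_proj \<lparr>pverts = set c, parcs = E \<inter> set c \<times> set c\<rparr>)"
    (is "biconnected (with_proj ?H)")
  unfolding biconnected_def
proof (intro conjI ballI impI)
  show "connected (with_proj ?H)" using connected_walk assms by blast
  fix v assume v: "v \<in> verts (with_proj ?H)" "verts (with_proj ?H) \<noteq> {v}"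
  then obtain c1 c2 where c: "c = c1 @ v # c2" using split_list[of v c] by fastforce
  \<comment> \<open>Reading the cycle from the successor of \<open>v\<close> round to its
    predecessor; the closing edge joins \<open>c2\<close> to \<open>c1\<close>.\<close>
  define p where "p = c2 @ c1"
  have set_p: "set p = set c - {v}" using c assms(2) by (auto simp: p_def)
  have "p \<noteq> []" using v c by (auto simp: p_def)
  moreover have "successively (\<lambda>x y. (x, y) \<in> E) p"
    using assms(3,4) c
    by (auto simp: p_def successively_append_iff successively_Cons hd_append split: if_splits)
  ultimately have "connected (with_proj \<lparr>pverts = set p, parcs = E \<inter> set p \<times> set p\<rparr>)"
    using connected_walk assms(5) by blast
  moreover have "pre_digraph.del_vert (with_proj ?H) v =
      with_proj \<lparr>pverts = set p, parcs = E \<inter> set p \<times> set p\<rparr>"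
    by (auto simp: pre_digraph.del_vert_def with_proj_def set_p)
  ultimately show "connected (pre_digraph.del_vert (with_proj ?H) v)" by simp
qed

text \<open>By finiteness, some subgraph with property \<open>P\<close> above \<open>H\<close> has
  the largest total number of vertices and arcs. Any such subgraph above it has the same size and
  therefore coincides with it.\<close>

lemma (in fin_digraph) subgraph_max_subgraphE:
  assumes "subgraph H G" "P H"
  obtains M where "max_subgraph P M" "subgraph H M"
proof -
  define Q where "Q K \<longleftrightarrow> subgraph K G \<and> P K \<and> subgraph H K" for K
  define size_of where "size_of K = card (verts K) + card (arcs K)" for K :: "('a, 'b) pre_digraph"
  have "wf_digraph H" using assms(1) by auto
  then have "Q H" using assms by (simp add: Q_def wf_digraph.subgraph_refl)
  moreover have "\<forall>K. Q K \<longrightarrow> size_of K < Suc (size_of G)"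
    by (auto simp: Q_def size_of_def less_Suc_eq_le intro!: add_mono card_mono)
  ultimately obtain M where M: "Q M" and max: "\<And>K. Q K \<Longrightarrow> size_of K \<le> size_of M"
    using Lattices_Big.ex_has_greatest_nat[of Q H size_of "Suc (size_of G)"] by blast
  have "\<not> (subgraph K G \<and> P K)" if "K \<noteq> M" "subgraph M K" for K
  proof
    assume K: "subgraph K G \<and> P K"
    then have "Q K" using M that(2) subgraph_trans by (auto simp: Q_def)
    then have le: "size_of K \<le> size_of M" by (rule max)
    have fin: "finite (verts K)" "finite (arcs K)"
      using K finite_subset[OF _ finite_verts] finite_subset[OF _ finite_arcs]
      by (auto elim!: subgraphE)
    have sub: "verts M \<subseteq> verts K" "arcs M \<subseteq> arcs K" using that(2) by auto
    have "card (verts M) \<le> card (verts K)" "card (arcs M) \<le> card (arcs K)"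
      using fin sub by (auto intro: card_mono)
    with le have "card (verts M) = card (verts K)" "card (arcs M) = card (arcs K)"
      by (auto simp: size_of_def)
    with fin sub have "verts M = verts K" "arcs M = arcs K"
      using card_subset_eq by metis+
    \<comment> \<open>Equality of the records also requires the incidence functions to agree, which
      compatibility provides.\<close>
    moreover have "tail M = tail K" "head M = head K"
      using that(2) by (auto simp: subgraph_def compatible_def)
    ultimately have "K = M" by simp
    with that show False by blast
  qed
  with M have "max_subgraph P M" by (auto simp: Q_def max_subgraph_def)
  with M that show ?thesis by (auto simp: Q_def)
qed

theorem theorem10:
  fixes G G' :: "'a pair_pre_digraph"
    and L :: "('a \<times> 'a) weight_fun"
    and S T u :: 'a
    and X :: "'a vwalk set"
    and r :: "'a vwalk"
    and i :: nat
  assumes "pair_graph G"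
    and "connected (with_proj G)"
    and "chordal G"
    and "edge_lengths G L"
    and "distinct_path_lengths G L"
    and "S \<in> pverts G" and "T \<in> pverts G" and "S \<noteq> T"
    and "\<forall>q \<in> X. normal_separator_path G L S T q"
    and "G' = remove_paths G X"
    and "r \<in> X"
    and "2 \<le> i" and "i < length r"
    and "u \<in> pverts G"
    and "strongly_path_connected G' r u (r ! (i - 2))"
    and "(u, r ! i) \<in> parcs G'"
  shows "\<exists>H. biconnected_component (with_proj G') H \<and> {u, r ! i, r ! (i - 2)} \<subseteq> verts H"
proof -
  interpret pair_graph G by fact
  define w where "w = r ! (i - 2)"
  have r: "separator_path G r" using assms(9,11) by (auto simp: normal_separator_path_def)
  have E': "parcs G' = parcs G - (\<Union>p\<in>X. path_edges p)" "pverts G' = pverts G"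
    using assms(10) by (auto simp: remove_paths_def)
  have sub: "parcs G' \<subseteq> parcs G - path_edges x" if "x \<in> X" for x using that E' by auto
  interpret G': pair_fin_digraph G'
    using pair_finite_verts pair_finite_arcs
    by unfold_locales (auto simp: E' dest: wellformed')
  have sym': "sym (parcs G')"
    unfolding E' by (rule sym_diff_path_edges[OF sym_parcs])
  obtain q0 where q0: "vwalk q0 (with_proj G')" "hd q0 = u" "last q0 = w" "set q0 \<inter> set r \<subseteq> {u, w}"
    using assms(15) unfolding strongly_path_connected_def w_def by blast
  \<comment> \<open>Shortening the walk to a simple path adds no vertices, so it still meets
    \<open>r\<close> at most in \<open>u\<close> and \<open>w\<close>.\<close>
  define q where "q = vwalk_to_vpath q0"
  have "vpath q (with_proj G')" "hd q = u" "last q = w" "set q \<subseteq> set q0"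
    using q0 by (auto simp: q_def vwalk_to_vpath_hd vwalk_to_vpath_last
        intro: vwalk_to_vpath_vpath dest: vwalk_to_vpath_subset)
  then have q: "q \<noteq> []" "distinct q" "hd q = u" "last q = w" "set q \<inter> set r \<subseteq> {u, w}"
    "set q \<subseteq> pverts G" "successively (\<lambda>x y. (x, y) \<in> parcs G') q"
    using q0(4) by (auto simp: vpath_def vwalk_def successively_iff_vwalk_arcs E'(2))
  have "(u, w) \<in> (parcs G' \<inter> set q \<times> set q)\<^sup>*"
    using successively_imp_rtrancl[OF q(7), of w] q(1,3,4) by auto
  then have "(w, u) \<in> (parcs G')\<^sup>*"
    using sym_rtranclD[OF sym'] rtrancl_mono[of "parcs G' \<inter> set q \<times> set q" "parcs G'"] by blast
  with assms(16) have reach: "(w, r ! i) \<in> (parcs G')\<^sup>*" by simp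
  have "(w, r ! i) \<in> parcs G"
    using separator_path_triangle[OF assms(2,3) r, of "i - 2"] assms(13)
    by (simp add: w_def le_add_diff_inverse2[OF assms(12)] del: add_2_eq_Suc')
  moreover have "(w, r ! i) \<notin> path_edges x" if "x \<in> X" for x
  proof
    assume "(w, r ! i) \<in> path_edges x"
    moreover have "separator_path G x"
      using assms(9) that by (auto simp: normal_separator_path_def)
    ultimately have "(w, r ! i) \<notin> (parcs G - path_edges x)\<^sup>*"
      using separator_path_edge_disconnected assms(2,3) by blast
    with reach rtrancl_mono[OF sub[OF that]] show False by blast
  qed
  ultimately have closing: "(w, r ! i) \<in> parcs G'" by (auto simp: E')
  \<comment> \<open>Since \<open>r ! i\<close> lies on \<open>r\<close>, it could occur on
    \<open>q\<close> only as \<open>u\<close> or \<open>w\<close>; it is adjacent to both, and there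
    are no loops.\<close>
  have "r ! i \<noteq> u" "r ! i \<noteq> w" 
    using assms(16) closing no_loops'[of u "r ! i"] no_loops'[of w "r ! i"] by (auto simp: E')
  then have "r ! i \<notin> set q" using q(5) assms(13) by auto
  \<comment> \<open>If \<open>u = w\<close>, then \<open>q\<close> is a single vertex and
    \<open>c\<close> consists of the ends of one edge.\<close>
  define c where "c = r ! i # q"
  define H where "H = \<lparr>pverts = set c, parcs = parcs G' \<inter> set c \<times> set c\<rparr>"
  have "(r ! i, u) \<in> parcs G'" using assms(16) sym' by (auto dest: symD)
  then have "biconnected (with_proj H)"
    unfolding H_def using q closing sym' \<open>r ! i \<notin> set q\<close>
    by (intro biconnected_cycle) (auto simp: c_def successively_Cons)
  moreover have "subgraph (with_proj H) (with_proj G')"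
  proof -
    have "pair_wf_digraph H" by unfold_locales (auto simp: H_def)
    moreover have "r ! i \<in> pverts G" using assms(16) E' wellformed' by blast
    ultimately show ?thesis
      using q(6) E' G'.wf_digraph_axioms
      by (auto simp: subgraph_def compatible_def H_def c_def wf_digraph_wp_iff)
  qed
  ultimately obtain M where "biconnected_component (with_proj G') M" "subgraph (with_proj H) M"
    unfolding biconnected_component_def
    by (metis G'.subgraph_max_subgraphE)
  moreover have "{u, r ! i, w} \<subseteq> verts (with_proj H)"
    using q(1,3,4) by (auto simp: H_def c_def)
  ultimately show ?thesis unfolding w_def by blast
qed

end
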